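(* Let $\alpha>1$ be a real algebraic number whose minimal polynomial over $\mathbb{Q}$ is $\mathfrak{m}_\alpha(X)=X^3+aX^2-bX-c$ with $a,b,c$ positive integers, and suppose that $\alpha$ is the unique positive root of $\mathfrak{m}_\alpha$. If the additive monoid $\mathbb{N}_0[\alpha]$ is atomic, then $\mathbb{N}_0[\alpha]$ is not an LFM.
   Context: $\mathbb{N}=\{1,2,3,\dots\}$ and $\mathbb{N}_0=\mathbb{N}\cup\{0\}$. For $\alpha\in\mathbb{R}_{>0}$, $\mathbb{N}_0[\alpha]=\{f(\alpha): f(X)\in\mathbb{N}_0[X]\}\subseteq\mathbb{R}_{\ge 0}$, viewed as a commutative cancellative monoid under addition. For a commutative cancellative monoid $(M,+,0)$: a unit is an element with an additive inverse in $M$; a nonunit $u\in M\setminus\{0\}$ is an atom if $u=v+w$ with $v,w\in M$ implies that $v$ or $w$ is a unit; $M$ is atomic if every nonzero nonunit is a finite sum of atoms. If $M$ is atomic, a factorization of $x\in M\setminus\{0\}$ is an expression $x=u_1+\cdots+u_k$ with $k\in\mathbb{N}$ and all $u_i$ atoms, considered up to permutation of the atoms; its length is $k$. An atomic monoid $M$ is an LFM (length-factorial monoid) if for every $x\neq 0$ any two distinct factorizations of $x$ have different lengths. *)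

theory Defs
  imports Complex_Main "HOL-Library.Multiset" "HOL-Computational_Algebra.Polynomial"
begin

text \<open>
  Commutative cancellative monoids are represented as additive submonoids \<open>M\<close> (sets containing
  \<open>0\<close> and closed under \<open>+\<close>) of an ambient commutative cancellative monoid; all notions below are
  relative to \<open>M\<close>.
\<close>

definition unit_in :: "'a::cancel_comm_monoid_add set \<Rightarrow> 'a \<Rightarrow> bool" where
  "unit_in M u \<longleftrightarrow> u \<in> M \<and> (\<exists>v\<in>M. u + v = 0)"

definition atom_in :: "'a::cancel_comm_monoid_add set \<Rightarrow> 'a \<Rightarrow> bool" where
  "atom_in M u \<longleftrightarrow> u \<in> M \<and> u \<noteq> 0 \<and> \<not> unit_in M u \<and>
     (\<forall>v\<in>M. \<forall>w\<in>M. u = v + w \<longrightarrow> unit_in M v \<or> unit_in M w)"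

text \<open>Multisets account for considering factorizations up to permutation of the atoms; the length
  of a factorization is its \<^const>\<open>size\<close>.\<close>

definition factorizations :: "'a::cancel_comm_monoid_add set \<Rightarrow> 'a \<Rightarrow> 'a multiset set" where
  "factorizations M x = {F. F \<noteq> {#} \<and> (\<forall>u\<in>#F. atom_in M u) \<and> x = \<Sum>\<^sub># F}"

definition atomic_monoid :: "'a::cancel_comm_monoid_add set \<Rightarrow> bool" where
  "atomic_monoid M \<longleftrightarrow>
     (\<forall>x\<in>M. x \<noteq> 0 \<longrightarrow> \<not> unit_in M x \<longrightarrow> factorizations M x \<noteq> {})"

definition LFM :: "'a::cancel_comm_monoid_add set \<Rightarrow> bool" where
  "LFM M \<longleftrightarrow> atomic_monoid M \<and>
     (\<forall>x\<in>M. x \<noteq> 0 \<longrightarrow>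
        (\<forall>F\<in>factorizations M x. \<forall>G\<in>factorizations M x. F \<noteq> G \<longrightarrow> size F \<noteq> size G))"

definition nat_poly_values :: "real \<Rightarrow> real set"  (\<open>\<nat>\<^sub>0[_]\<close>) where
  "\<nat>\<^sub>0[\<alpha>] = range (\<lambda>f :: nat poly. poly (map_poly of_nat f) \<alpha>)"

lemma zero_in_nat_poly_values: "0 \<in> \<nat>\<^sub>0[\<alpha>]"
  unfolding nat_poly_values_def by (rule range_eqI[of _ _ 0]) simp

lemma add_in_nat_poly_values:
  assumes "x \<in> \<nat>\<^sub>0[\<alpha>]" "y \<in> \<nat>\<^sub>0[\<alpha>]"
  shows "x + y \<in> \<nat>\<^sub>0[\<alpha>]"
proof -
  from assms obtain f g :: "nat poly"
    where "x = poly (map_poly of_nat f) \<alpha>" "y = poly (map_poly of_nat g) \<alpha>"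
    unfolding nat_poly_values_def by blast
  moreover have "map_poly of_nat (f + g) = (map_poly of_nat f + map_poly of_nat g :: real poly)"
    by (intro poly_eqI) (simp add: coeff_map_poly)
  ultimately have "x + y = poly (map_poly of_nat (f + g)) \<alpha>"
    by simp
  then show ?thesis
    unfolding nat_poly_values_def by (rule range_eqI)
qed

definition is_minimal_polynomial :: "rat poly \<Rightarrow> real \<Rightarrow> bool" where
  "is_minimal_polynomial p \<alpha> \<longleftrightarrow>
     lead_coeff p = 1 \<and> poly (map_poly of_rat p) \<alpha> = 0 \<and>
     (\<forall>q :: rat poly. q \<noteq> 0 \<longrightarrow> poly (map_poly of_rat q) \<alpha> = 0 \<longrightarrow> degree p \<le> degree q)"

end

theory Submission
  imports Defs
begin

text \<open>
  Since \<open>\<alpha> > 1\<close>, a power \<open>\<alpha>\<^sup>k\<close> can only be decomposed in \<open>\<nat>\<^sub>0[\<alpha>]\<close> by means of smaller powers of \<open>\<alpha>\<close>.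
  For \<open>k \<le> 4\<close> such a decomposition yields a monic multiple of the minimal polynomial of degree \<open>k\<close>
  whose lower coefficients are all nonpositive. The signs of \<open>X\<^sup>3 + aX\<^sup>2 - bX - c\<close> exclude this:
  for \<open>k = 4\<close> the cofactor would be \<open>X - t\<close> with \<open>t \<ge> a > 0\<close>, making the constant term
  \<open>tc\<close> positive. Hence \<open>1, \<alpha>, \<dots>, \<alpha>\<^sup>4\<close> are atoms. Multiplying the minimal polynomial by \<open>X - 1\<close>, which
  makes the coefficients add up to zero, then gives a relation between two factorizations
  of equal length.
\<close>

lemma nat_poly_value_eq_sum:
  "poly (map_poly of_nat f) (\<alpha>::real) = (\<Sum>i\<le>degree f. real (coeff f i) * \<alpha> ^ i)"
proof -
  have "degree (map_poly (of_nat :: nat \<Rightarrow> real) f) = degree f"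
    by (rule degree_map_poly) simp
  then show ?thesis
    by (simp add: poly_altdef coeff_map_poly)
qed

lemma nat_poly_values_nonneg:
  assumes "\<alpha> \<ge> 0" "x \<in> \<nat>\<^sub>0[\<alpha>]"
  shows "x \<ge> 0"
  using assms by (auto simp: nat_poly_values_def nat_poly_value_eq_sum intro!: sum_nonneg)

lemma unit_in_nat_poly_values_iff:
  assumes "\<alpha> \<ge> 0"
  shows "unit_in \<nat>\<^sub>0[\<alpha>] u \<longleftrightarrow> u = 0"
proof
  assume "unit_in \<nat>\<^sub>0[\<alpha>] u"
  then obtain v where "u \<in> \<nat>\<^sub>0[\<alpha>]" "v \<in> \<nat>\<^sub>0[\<alpha>]" "u + v = 0"
    by (auto simp: unit_in_def)
  with nat_poly_values_nonneg[OF assms] show "u = 0"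
    by (metis add_nonneg_eq_0_iff)
qed (auto simp: unit_in_def zero_in_nat_poly_values)

lemma power_in_nat_poly_values: "\<alpha> ^ k \<in> \<nat>\<^sub>0[\<alpha>]"
  unfolding nat_poly_values_def
  by (rule range_eqI[of _ _ "monom 1 k"]) (simp add: map_poly_monom poly_monom)

text \<open>As \<open>\<alpha> > 1\<close>, a single nonzero coefficient at an index
  \<open>i \<ge> k\<close> would already contribute at least \<open>\<alpha> ^ k\<close>, and the
  other terms are nonnegative.\<close>

lemma nat_poly_values_less_power:
  assumes "\<alpha> > 1" "x \<in> \<nat>\<^sub>0[\<alpha>]" "x < \<alpha> ^ k"
  obtains h :: "nat \<Rightarrow> nat" where "x = (\<Sum>i<k. real (h i) * \<alpha> ^ i)"
proof -
  obtain f where x: "x = poly (map_poly of_nat f) \<alpha>"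
    using assms(2) by (auto simp: nat_poly_values_def)
  have zero: "coeff f i = 0" if "i \<ge> k" for i
  proof (rule ccontr)
    assume nz: "coeff f i \<noteq> 0"
    have "\<alpha> ^ k \<le> \<alpha> ^ i"
      using assms(1) that by (simp add: power_increasing)
    also have "\<dots> \<le> real (coeff f i) * \<alpha> ^ i"
      using nz assms(1) by simp
    also have "\<dots> \<le> (\<Sum>j\<le>degree f. real (coeff f j) * \<alpha> ^ j)"
      using nz assms(1) by (intro member_le_sum) (auto intro: le_degree)
    finally show False
      using assms(3) by (simp add: x nat_poly_value_eq_sum)
  qed
  have "x = (\<Sum>i<k. real (coeff f i) * \<alpha> ^ i)"
    unfolding x nat_poly_value_eq_sum
    by (rule sum.mono_neutral_cong) (use zero in \<open>auto simp: coeff_eq_0 not_less not_le\<close>)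
  then show thesis
    by (rule that)
qed

text \<open>Nonzero summands are positive, so both lie strictly below \<open>\<alpha> ^ k\<close>
  and involve only lower powers. Adding their coefficients contradicts the second
  assumption.\<close>

lemma atom_in_powerI:
  assumes "\<alpha> > 1"
    and indecomposable: "\<And>h :: nat \<Rightarrow> nat. \<alpha> ^ k \<noteq> (\<Sum>i<k. real (h i) * \<alpha> ^ i)"
  shows "atom_in \<nat>\<^sub>0[\<alpha>] (\<alpha> ^ k)"
proof -
  have False
    if v: "v \<in> \<nat>\<^sub>0[\<alpha>]" "v \<noteq> 0"
      and w: "w \<in> \<nat>\<^sub>0[\<alpha>]" "w \<noteq> 0"
      and eq: "\<alpha> ^ k = v + w" for v w
  proof -
    have "v > 0" "w > 0"
      using nat_poly_values_nonneg[of \<alpha>] v w \<open>\<alpha> > 1\<close> by (force simp: less_le)+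
    then have "v < \<alpha> ^ k" "w < \<alpha> ^ k"
      using eq by simp_all
    obtain f :: "nat \<Rightarrow> nat" where "v = (\<Sum>i<k. real (f i) * \<alpha> ^ i)"
      using nat_poly_values_less_power[OF \<open>\<alpha> > 1\<close> v(1) \<open>v < \<alpha> ^ k\<close>] .
    moreover obtain g :: "nat \<Rightarrow> nat" where "w = (\<Sum>i<k. real (g i) * \<alpha> ^ i)"
      using nat_poly_values_less_power[OF \<open>\<alpha> > 1\<close> w(1) \<open>w < \<alpha> ^ k\<close>] .
    ultimately show False
      using eq indecomposable[of "\<lambda>i. f i + g i"]
      by (simp add: sum.distrib algebra_simps)
  qed
  then show ?thesis
    using assms(1) by (auto simp: atom_in_def unit_in_nat_poly_values_iff power_in_nat_poly_values)
qed

text \<open>A nonzero polynomial of degree at most 2 cannot vanish at \<open>\<alpha>\<close>.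
  Integer coefficients suit the relations obtained below by subtracting natural numbers.\<close>

lemma is_minimal_polynomial_degree3_independent:
  fixes r s t :: int
  assumes "is_minimal_polynomial p \<alpha>" "degree p = 3"
    and eq: "of_int t * \<alpha>\<^sup>2 + of_int s * \<alpha> + of_int r = 0"
  shows "r = 0" "s = 0" "t = 0"
proof -
  let ?q = "[:of_int r, of_int s, of_int t:] :: rat poly"
  have "poly (map_poly of_rat ?q) \<alpha> = 0"
    using eq by (simp add: map_poly_pCons algebra_simps power2_eq_square)
  moreover have "degree ?q \<le> 2"
    by (rule degree_le) (auto simp: coeff_pCons split: nat.splits)
  moreover have "q \<noteq> 0 \<Longrightarrow> poly (map_poly of_rat q) \<alpha> = 0 \<Longrightarrow> 3 \<le> degree q" for q :: "rat poly"
    using assms(1,2) by (auto simp: is_minimal_polynomial_def)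
  moreover have "\<not> 3 \<le> degree ?q"
    using calculation(2) by linarith
  ultimately have "?q = 0"
    by blast
  then show "r = 0" "s = 0" "t = 0"
    by simp_all
qed

theorem proposition13:
  fixes \<alpha> :: real and a b c :: nat and m :: "rat poly"
  assumes "\<alpha> > 1" and "algebraic \<alpha>"
    and "a > 0" and "b > 0" and "c > 0"
    and "m = [:- of_nat c, - of_nat b, of_nat a, 1:]"
    and "is_minimal_polynomial m \<alpha>"
    and "\<forall>x::real. x > 0 \<longrightarrow> poly (map_poly of_rat m) x = 0 \<longrightarrow> x = \<alpha>"
    and "atomic_monoid \<nat>\<^sub>0[\<alpha>]"
  shows "\<not> LFM \<nat>\<^sub>0[\<alpha>]"
proof -
  have "poly (map_poly of_rat m) \<alpha> = 0"
    using assms(7) by (simp add: is_minimal_polynomial_def)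
  then have cubic: "\<alpha> ^ 3 = real b * \<alpha> + real c - real a * \<alpha>\<^sup>2"
    by (simp add: assms(6) map_poly_pCons of_rat_minus algebra_simps power2_eq_square power3_eq_cube)
  then have quartic: "\<alpha> ^ 4 = real b * \<alpha>\<^sup>2 + real c * \<alpha> - real a * \<alpha> ^ 3"
    by algebra
  have "degree m = 3"
    by (simp add: assms(6))
  note indep = is_minimal_polynomial_degree3_independent[OF assms(7) this]

  have atom: "atom_in \<nat>\<^sub>0[\<alpha>] (\<alpha> ^ k)" if k: "k \<le> 4" for k
  proof (rule atom_in_powerI[OF assms(1)])
    fix h :: "nat \<Rightarrow> nat"
    show "\<alpha> ^ k \<noteq> (\<Sum>i<k. real (h i) * \<alpha> ^ i)"
    proof
      assume eq: "\<alpha> ^ k = (\<Sum>i<k. real (h i) * \<alpha> ^ i)"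
      \<comment> \<open>For \<open>k = 0\<close> the sum is empty. For \<open>k = 1, 2\<close> the
        relation already has degree below 3; for \<open>k = 3, 4\<close> it is first reduced by
        \<open>cubic\<close> and \<open>quartic\<close>.\<close>
      consider "k = 0" | "k = 1" | "k = 2" | "k = 3" | "k = 4"
        using k by linarith
      then show False
      proof cases
        case 1
        then show False using eq by simp
      next
        case 2
        then have "of_int 0 * \<alpha>\<^sup>2 + of_int 1 * \<alpha> + of_int (- int (h 0)) = 0"
          using eq by simp
        then have "(1::int) = 0" by (rule indep(2))
        then show False by simp
      next
        case 3
        then have "of_int 1 * \<alpha>\<^sup>2 + of_int (- int (h 1)) * \<alpha> + of_int (- int (h 0)) = 0"
          using eq by (simp add: eval_nat_numeral)
        then have "(1::int) = 0" by (rule indep(3))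
        then show False by simp
      next
        case 4
        then have "of_int (int a + int (h 2)) * \<alpha>\<^sup>2 + of_int (int (h 1) - int b) * \<alpha>
            + of_int (int (h 0) - int c) = 0"
          using eq cubic by (simp add: eval_nat_numeral algebra_simps)
        then have "int a + int (h 2) = 0" by (rule indep(3))
        then show False using assms(3) by simp
      next
        case 5
        \<comment> \<open>Eliminating \<open>\<alpha> ^ 4\<close> by \<open>quartic\<close> leaves
          \<open>\<alpha> ^ 3\<close> with this coefficient; \<open>cubic\<close> then removes
          \<open>\<alpha> ^ 3\<close> and turns the constant term into
          \<open>h 0 + t * c\<close>.\<close>
        define t where "t = h 3 + a"
        have "real b * \<alpha>\<^sup>2 + real c * \<alpha> =
            real t * \<alpha> ^ 3 + real (h 2) * \<alpha>\<^sup>2 + real (h 1) * \<alpha> + real (h 0)"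
          using eq quartic 5 by (simp add: t_def lessThan_nat_numeral lessThan_Suc algebra_simps)
        then have "of_int (int (h 2) - int b - int t * int a) * \<alpha>\<^sup>2
            + of_int (int (h 1) - int c + int t * int b) * \<alpha>
            + of_int (int (h 0) + int t * int c) = 0"
          unfolding cubic by (simp add: algebra_simps)
        then have "int (h 0) + int t * int c = 0" by (rule indep(1))
        moreover have "int t * int c > 0"
          using assms(3,5) by (simp add: t_def)
        ultimately show False by simp
      qed
    qed
  qed

  \<comment> \<open>Positive and negative terms of \<open>(X - 1) * (X^3 + a X^2 - b X - c)\<close>.
    The linear coefficient \<open>b - c\<close> may have either sign, so \<open>b\<close> goes to
    \<open>?F\<close> and \<open>c\<close> to \<open>?G\<close> without cancelling.\<close>
  let ?F = "replicate_mset 1 (\<alpha> ^ 4) + replicate_mset (a - 1) (\<alpha> ^ 3)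
    + replicate_mset b (\<alpha> ^ 1) + replicate_mset c (\<alpha> ^ 0)"
  let ?G = "replicate_mset (a + b) (\<alpha> ^ 2) + replicate_mset c (\<alpha> ^ 1)"
  \<comment> \<open>This is \<open>quartic\<close> minus \<open>cubic\<close>; \<open>a > 0\<close>
    makes \<open>a - 1\<close> a genuine difference.\<close>
  have sum_eq: "\<Sum>\<^sub># ?F = \<Sum>\<^sub># ?G"
    using cubic quartic assms(3)
    by (simp add: sum_mset_replicate_mset of_nat_diff algebra_simps del: One_nat_def)
  have "?F \<in> factorizations \<nat>\<^sub>0[\<alpha>] (\<Sum>\<^sub># ?G)"
    unfolding factorizations_def sum_eq[symmetric]
    using atom[of 4] atom[of 3] atom[of 1] atom[of 0] by (auto split: if_splits)
  moreover have "?G \<in> factorizations \<nat>\<^sub>0[\<alpha>] (\<Sum>\<^sub># ?G)"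
    unfolding factorizations_def
    using atom[of 2] atom[of 1] assms(4) by (auto split: if_splits)
  moreover have "size ?F = size ?G"
    using assms(3) by simp
  moreover have "?F \<noteq> ?G"
  proof
    assume "?F = ?G"
    \<comment> \<open>The atom \<open>\<alpha> ^ 4\<close> tells the two apart: \<open>?G\<close>
      has only \<open>\<alpha> ^ 2\<close> and \<open>\<alpha>\<close>, and the powers of
      \<open>\<alpha> > 1\<close> are distinct.\<close>
    then have "\<alpha> ^ 4 \<in># ?G"
      by (metis union_iff in_replicate_mset zero_less_one)
    then have "\<alpha> ^ 4 = \<alpha> ^ 2 \<or> \<alpha> ^ 4 = \<alpha> ^ 1"
      by (auto split: if_splits)
    then show False
      using assms(1) power_inject_exp[of \<alpha> 4 2] power_inject_exp[of \<alpha> 4 1] by simp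
  qed
  moreover have "\<Sum>\<^sub># ?G \<in> \<nat>\<^sub>0[\<alpha>]"
  proof -
    have "\<Sum>\<^sub># A \<in> \<nat>\<^sub>0[\<alpha>]" if "\<forall>u\<in>#A. u \<in> \<nat>\<^sub>0[\<alpha>]" for A
      using that by (induction A) (auto simp: zero_in_nat_poly_values add_in_nat_poly_values)
    moreover have "\<forall>u\<in>#?G. u \<in> \<nat>\<^sub>0[\<alpha>]"
      using power_in_nat_poly_values[of \<alpha>] by (metis union_iff in_replicate_mset)
    ultimately show ?thesis by blast
  qed
  moreover have "\<Sum>\<^sub># ?G \<noteq> 0"
  proof -
    have "real (a + b) * \<alpha>\<^sup>2 > 0" "real c * \<alpha> > 0"
      using assms(1,3,5) by simp_all
    then show ?thesis
      by (simp add: sum_mset_replicate_mset)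
  qed
  ultimately show ?thesis
    unfolding LFM_def by blast
qed

end
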